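(* Let $p$ be an odd prime, $m>1$ an integer with $p\equiv1\pmod m$, $\alpha=(p-1)/m$, and let $\mathbf a=(a_1,a_2,a_3,a_4)$ be integers with $0<a_i<m$, $\gcd(m,a_1,\dots,a_4)=1$ and $a_1+a_2+a_3+a_4=2m$. Let $\Phi_{\mathbf a}(\lambda)\in\mathbb F_p[\lambda]$ be the $\mathbf a$-Hasse invariant. Then $u=\Phi_{\mathbf a}(\lambda)$ is a solution (in characteristic $p$) of the hypergeometric differential equation $$\lambda(1-\lambda)u''+[C-(A+B+1)\lambda]u'-ABu=0,$$ where $A\equiv-\alpha a_3$, $B\equiv\alpha(a_4-m)$ and $C\equiv-\alpha(a_2+a_3)\pmod p$.
   Context: Let $k$ be an algebraically closed field of characteristic $p$, $\lambda$ an indeterminate, and $\chi:\mathbb Z/m\to\mathbb F_p^\times$ an injective character. Let $\bar Z_0$ be the smooth projective curve $z^m=x^{a_1}(x-1)^{a_2}(x-\lambda)^{a_4}$ over $k(\lambda)$ with automorphism $\psi$, $\psi^*z=\chi(1)z$, $\psi^*x=x$. The space $H^0(\bar Z_0,\Omega^1)_\chi$ of regular differentials with $\psi^*\omega=\chi(1)\omega$ is one-dimensional with basis $\omega=\dfrac{z\,dx}{x(x-1)(x-\lambda)}$. The $\mathbf a$-Hasse invariant $\Phi_{\mathbf a}$ is defined by $\mathcal C\omega=\Phi_{\mathbf a}(\lambda)^{1/p}\omega$, with $\mathcal C$ the Cartier operator; explicitly $$\Phi_{\mathbf a}(\lambda)=(-1)^{\alpha a_3}\sum_{i+j=\alpha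 a_3}\binom{\alpha(m-a_2)}{i}\binom{\alpha(m-a_4)}{j}\lambda^j .$$ *)

theory Defs
  imports "HOL-Algebra.Algebraic_Closure_Type" "HOL-Algebra.Generated_Fields"
    "HOL-Number_Theory.Cong"
begin

text \<open>
  Since \<open>k(\<lambda>)\<close> is not perfect and \<open>\<Phi>(\<lambda>)\<close> need not be a \<open>p\<close>-th power in it, the Cartier
  operator lives on the base change of the curve to an algebraic closure of \<open>k(\<lambda>)\<close>, the type
  \<open>'k const_field\<close>. The type \<open>'k ambient\<close> is an algebraic closure of the rational function
  field in \<open>x\<close> over \<open>'k const_field\<close>. The function field of the curve is a subfield of it.
\<close>

type_synonym 'k const_field = "'k poly fract alg_closure"
type_synonym 'k ambient = "'k const_field poly fract alg_closure"

definition at_lambda :: "'k::field poly \<Rightarrow> 'k const_field" where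
  "at_lambda f = to_ac (to_fract f)"

definition const_emb :: "'k::field const_field \<Rightarrow> 'k ambient" where
  "const_emb c = to_ac (to_fract [:c:])"

definition lam :: "'k::field ambient" where
  "lam = const_emb (at_lambda [:0, 1:])"

definition var_x :: "'k::field ambient" where
  "var_x = to_ac (to_fract [:0, 1:])"

text \<open>
  The point at infinity has ramification datum \<open>a3 = 2 * m - a1 - a2 - a4\<close>, so \<open>a3\<close> does not
  occur in the equation.
\<close>

definition on_curve :: "nat \<Rightarrow> nat \<Rightarrow> nat \<Rightarrow> nat \<Rightarrow> 'k::field ambient \<Rightarrow> bool" where
  "on_curve m a1 a2 a4 z \<longleftrightarrow> z ^ m = var_x ^ a1 * (var_x - 1) ^ a2 * (var_x - lam) ^ a4"

definition curve_field :: "'k::field ambient \<Rightarrow> 'k ambient set" where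
  "curve_field z = generate_field ring_of_type_algebra (range const_emb \<union> {var_x, z})"

text \<open>
  Let \<open>F\<close> be a function field of one variable over a perfect field of characteristic \<open>p\<close>, with
  separating element \<open>x\<close>. Its differentials are the \<open>f dx\<close> with \<open>f\<close> in \<open>F\<close>, and \<open>f dx\<close> is
  represented by its coefficient \<open>f\<close>. Every \<open>f\<close> is uniquely
  \<open>f\<^sub>0^p + f\<^sub>1^p x + \<dots> + f\<^sub>p\<^sub>-\<^sub>1^p x^(p-1)\<close> with all coefficients in \<open>F\<close>, and the Cartier operator sends
  \<open>f dx\<close> to \<open>f\<^sub>p\<^sub>-\<^sub>1 dx\<close>.
\<close>

definition cartier :: "'a::field set \<Rightarrow> 'a \<Rightarrow> 'a \<Rightarrow> 'a" where
  "cartier F x f = (THE h. \<exists>g. (\<forall>i<CHAR('a). g i \<in> F) \<and>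
     f = (\<Sum>i<CHAR('a). g i ^ CHAR('a) * x ^ i) \<and> h = g (CHAR('a) - 1))"

definition omega :: "'k::field ambient \<Rightarrow> 'k ambient" where
  "omega z = z / (var_x * (var_x - 1) * (var_x - lam))"

text \<open>
  The equation \<open>C \<omega> = \<Phi>(\<lambda>)^(1/p) \<omega>\<close>, where \<open>c\<close> is the unique \<open>p\<close>-th root of \<open>\<Phi>(\<lambda>)\<close>. The set
  \<open>\<int>\<close> of integers of \<open>'k\<close> is its prime field, so \<open>\<Phi>\<close> is in \<open>F\<^sub>p[\<lambda>]\<close>.
  The \<open>m\<close>-th roots \<open>z\<close> differ by factors in \<open>F\<^sub>p\<close> when \<open>m\<close> divides \<open>p - 1\<close>, so they all impose
  the same condition.
\<close>

definition is_hasse_invariant ::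
    "nat \<Rightarrow> nat \<Rightarrow> nat \<Rightarrow> nat \<Rightarrow> 'k::alg_closed_field poly \<Rightarrow> bool" where
  "is_hasse_invariant m a1 a2 a4 \<Phi> \<longleftrightarrow> set (coeffs \<Phi>) \<subseteq> \<int> \<and>
     (\<forall>z. on_curve m a1 a2 a4 z \<longrightarrow>
       (\<exists>c. c ^ CHAR('k) = at_lambda \<Phi> \<and>
            cartier (curve_field z) var_x (omega z) = const_emb c * omega z))"

definition hasse_invariant ::
    "nat \<Rightarrow> nat \<Rightarrow> nat \<Rightarrow> nat \<Rightarrow> 'k::alg_closed_field poly" where
  "hasse_invariant m a1 a2 a4 = (THE \<Phi>. is_hasse_invariant m a1 a2 a4 \<Phi>)"

end

theory Submission
  imports Defs
begin

text \<open>
  With \<open>N = x^(\<alpha>(m-a1)) (x-1)^(\<alpha>(m-a2)) (x-\<lambda>)^(\<alpha>(m-a4))\<close>, the equation of the curve gives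
  \<open>\<omega> = \<omega>^p N\<close> for the coefficient of the basis differential. The constant field is perfect, so
  \<open>N = \<Sum> q\<^sub>i^p x^i\<close>, and for degree reasons \<open>q\<^sub>p\<^sub>-\<^sub>1\<close> is the constant \<open>c\<close> with \<open>c^p\<close> equal to
  the coefficient of \<open>x^(p-1)\<close> in \<open>N\<close>. Hence \<open>\<C> \<omega> = c \<omega>\<close>, once \<open>1, x, \<dots>, x^(p-1)\<close> are known to
  be independent over the \<open>p\<close>-th powers of the function field. The Hasse invariant is therefore
  that coefficient, a sum of products of binomial coefficients whose consecutive terms satisfy
  the hypergeometric recursion modulo \<open>p\<close>.
\<close>

section \<open>Characteristic, and coefficients of p-th powers of polynomials\<close>

lemma to_fract_of_nat: "to_fract (of_nat n) = of_nat n"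
  by (induction n) simp_all

lemma CHAR_fract [simp]: "CHAR('a::idom fract) = CHAR('a)"
proof (rule CHAR_eqI)
  show "of_nat CHAR('a) = (0 :: 'a fract)"
    by (simp flip: to_fract_of_nat)
  show "CHAR('a) dvd n" if "of_nat n = (0 :: 'a fract)" for n
    using that by (simp add: of_nat_eq_0_iff_char_dvd flip: to_fract_of_nat)
qed

lemma to_fract_power: "to_fract (x ^ n) = to_fract x ^ n"
  by (induction n) simp_all

text \<open>Frobenius is additive, so it raises each coefficient to the power p and multiplies each
  exponent by p.\<close>

lemma coeff_power_CHAR:
  fixes q :: "'a::comm_ring_1 poly"
  assumes "prime CHAR('a)"
  shows "coeff (q ^ CHAR('a)) n = (if CHAR('a) dvd n then coeff q (n div CHAR('a)) ^ CHAR('a) else 0)"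
proof -
  let ?p = "CHAR('a)"
  have p: "?p > 0" using assms by (simp add: prime_gt_0_nat)
  have "q ^ ?p = (\<Sum>i\<le>degree q. monom (coeff q i) i) ^ ?p"
    by (simp add: poly_as_sum_of_monoms)
  also have "\<dots> = (\<Sum>i\<le>degree q. monom (coeff q i ^ ?p) (?p * i))"
    by (subst freshmans_dream_sum) (use assms in \<open>simp_all add: monom_power mult.commute\<close>)
  finally have "coeff (q ^ ?p) n = (\<Sum>i\<le>degree q. if ?p * i = n then coeff q i ^ ?p else 0)"
    by (simp add: coeff_sum)
  also have "\<dots> = (if ?p dvd n then coeff q (n div ?p) ^ ?p else 0)"
  proof (cases "?p dvd n")
    case True
    then obtain k where k: "n = ?p * k" by blast
    have "(\<Sum>i\<le>degree q. if ?p * i = n then coeff q i ^ ?p else 0) =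
          (\<Sum>i\<le>degree q. if i = k then coeff q i ^ ?p else 0)"
      using p k by (intro sum.cong) auto
    also have "\<dots> = coeff q k ^ ?p"
      using p by (simp add: coeff_eq_0 zero_power)
    finally show ?thesis using k p by simp
  qed (auto intro!: sum.neutral)
  finally show ?thesis .
qed

text \<open>The summand with index \<open>i\<close> only has exponents congruent to \<open>i\<close>
  modulo p. Since \<open>i\<close> is below p, each exponent receives a contribution from exactly
  one summand, the one indexed by its remainder.\<close>

lemma coeff_sum_power_CHAR:
  fixes q :: "nat \<Rightarrow> 'a::comm_ring_1 poly"
  assumes "prime CHAR('a)"
  shows "coeff (\<Sum>i<CHAR('a). q i ^ CHAR('a) * [:0, 1:] ^ i) n =
         coeff (q (n mod CHAR('a))) (n div CHAR('a)) ^ CHAR('a)"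
proof -
  let ?p = "CHAR('a)"
  have p: "?p > 0" using assms by (simp add: prime_gt_0_nat)
  have dvd: "i = n mod ?p" if "i < ?p" "i \<le> n" "?p dvd n - i" for i
    using that by (metis mod_eq_dvd_iff_nat mod_less)
  have "coeff (q i ^ ?p * [:0, 1:] ^ i) n =
        (if i = n mod ?p then coeff (q i) (n div ?p) ^ ?p else 0)" if "i < ?p" for i
  proof -
    have "q i ^ ?p * [:0, 1:] ^ i = monom 1 i * q i ^ ?p"
      by (simp add: monom_altdef mult.commute)
    then have *: "coeff (q i ^ ?p * [:0, 1:] ^ i) n = (if n < i then 0 else coeff (q i ^ ?p) (n - i))"
      by (simp add: coeff_monom_mult)
    show ?thesis
    proof (cases "i = n mod ?p")
      case True
      then have "\<not> n < i" "n - i = ?p * (n div ?p)"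
        by (simp_all add: minus_mod_eq_mult_div not_less)
      with True p show ?thesis
        unfolding * coeff_power_CHAR[OF assms] by simp
    next
      case False
      then have "\<not> ?p dvd n - i" if "i \<le> n"
        using dvd[OF \<open>i < ?p\<close> that] by blast
      with False show ?thesis
        unfolding * coeff_power_CHAR[OF assms] by (cases "n < i") simp_all
    qed
  qed
  then have "coeff (\<Sum>i<?p. q i ^ ?p * [:0, 1:] ^ i) n =
      (\<Sum>i<?p. if i = n mod ?p then coeff (q i) (n div ?p) ^ ?p else 0)"
    by (simp add: coeff_sum)
  then show ?thesis using p by simp
qed

section \<open>Expansion in 1, x, ..., x^(p-1) over p-th powers: uniqueness and existence\<close>

lemma poly_p_independent:
  fixes q :: "nat \<Rightarrow> 'a::idom poly"
  assumes "prime CHAR('a)" and "(\<Sum>i<CHAR('a). q i ^ CHAR('a) * [:0, 1:] ^ i) = 0"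
    and "i < CHAR('a)"
  shows "q i = 0"
proof (rule poly_eqI)
  fix k
  have "coeff (q i) k ^ CHAR('a) = 0"
    using coeff_sum_power_CHAR[OF assms(1), of q "CHAR('a) * k + i"] assms(2,3) by simp
  then show "coeff (q i) k = coeff 0 k" by simp
qed

text \<open>Sort the exponents of \<open>f\<close> by residue modulo p and take p-th roots of the
  coefficients, which exist over an algebraically closed field.\<close>

lemma poly_p_decomposition:
  fixes f :: "'a::alg_closed_field poly"
  assumes "prime CHAR('a)"
  obtains q where "f = (\<Sum>i<CHAR('a). q i ^ CHAR('a) * [:0, 1:] ^ i)"
proof -
  let ?p = "CHAR('a)"
  have p: "?p > 0" using assms by (simp add: prime_gt_0_nat)
  define r where "r = (\<lambda>c::'a. SOME y. y ^ ?p = c)"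
  have r: "r c ^ ?p = c" for c
    unfolding r_def by (rule someI_ex) (use nth_root_exists[OF p] in blast)
  \<comment> \<open>This makes the finite sum \<open>q i\<close> have the intended coefficient also
    beyond \<open>degree f\<close>, where it stops.\<close>
  have r0: "r 0 = 0" using r[of 0] p by simp
  define q where "q = (\<lambda>i. \<Sum>k\<le>degree f. monom (r (coeff f (?p * k + i))) k)"
  have "coeff (q i) k = r (coeff f (?p * k + i))" for i k
  proof (cases "k \<le> degree f")
    case False
    moreover have "k \<le> ?p * k" using p by simp
    ultimately have "coeff f (?p * k + i) = 0" by (intro coeff_eq_0) linarith
    with False show ?thesis by (simp add: q_def coeff_sum r0)
  qed (simp add: q_def coeff_sum)
  then have "f = (\<Sum>i<?p. q i ^ ?p * [:0, 1:] ^ i)"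
    by (intro poly_eqI) (simp add: coeff_sum_power_CHAR[OF assms] r)
  then show ?thesis by (rule that)
qed

text \<open>Used to carry p-independence from polynomials over to rational functions.\<close>

lemma common_denominator:
  fixes r :: "'b \<Rightarrow> 'a::idom fract"
  assumes "finite I"
  obtains d q where "d \<noteq> 0" "\<And>i. i \<in> I \<Longrightarrow> r i * to_fract d = to_fract (q i)"
proof -
  have "\<exists>d. d \<noteq> 0 \<and> (\<forall>i\<in>I. \<exists>q. r i * to_fract d = to_fract q)"
    using assms
  proof induction
    case empty
    show ?case by (auto intro: exI[of _ 1])
  next
    case (insert j I)
    then obtain d where d: "d \<noteq> 0" "\<forall>i\<in>I. \<exists>q. r i * to_fract d = to_fract q" by blast
    obtain a b where ab: "b \<noteq> 0" "r j = Fract a b" by (cases "r j")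
    show ?case
    proof (rule exI[of _ "d * b"], rule conjI[OF _ ballI])
      fix i assume i: "i \<in> insert j I"
      show "\<exists>q. r i * to_fract (d * b) = to_fract q"
      proof (cases "i = j")
        case True
        then have "r i * to_fract (d * b) = to_fract (a * d)"
          using ab by (simp add: Fract_conv_to_fract)
        then show ?thesis ..
      next
        case False
        then obtain q where "r i * to_fract d = to_fract q" using d i by blast
        then have "r i * to_fract (d * b) = to_fract (q * b)" by (simp flip: mult.assoc)
        then show ?thesis ..
      qed
    qed (use d ab in simp)
  qed
  then obtain d where "d \<noteq> 0" "\<forall>i\<in>I. \<exists>q. r i * to_fract d = to_fract q" by blast
  then show ?thesis using that by metis
qed

lemma fract_p_independent:
  fixes r :: "nat \<Rightarrow> 'a::idom poly fract"
  assumes "prime CHAR('a)" and "(\<Sum>i<CHAR('a). r i ^ CHAR('a) * to_fract [:0, 1:] ^ i) = 0"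
    and "i < CHAR('a)"
  shows "r i = 0"
proof -
  let ?p = "CHAR('a)"
  obtain d q where d: "d \<noteq> 0" "\<And>i. i \<in> {..<?p} \<Longrightarrow> r i * to_fract d = to_fract (q i)"
    using common_denominator[of "{..<?p}" r] by blast
  \<comment> \<open>The coefficients enter only through their p-th powers, so clearing denominators
    multiplies the whole relation by the p-th power of \<open>d\<close>.\<close>
  have "to_fract (\<Sum>i<?p. q i ^ ?p * [:0, 1:] ^ i) =
        (\<Sum>i<?p. (r i * to_fract d) ^ ?p * to_fract [:0, 1:] ^ i)"
    using d(2) by (auto simp: to_fract_power intro!: sum.cong)
  also have "\<dots> = to_fract d ^ ?p * (\<Sum>i<?p. r i ^ ?p * to_fract [:0, 1:] ^ i)"
    by (simp add: sum_distrib_left power_mult_distrib mult_ac)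
  finally have "(\<Sum>i<?p. q i ^ ?p * [:0, 1:] ^ i) = 0"
    using assms(2) by (simp del: to_fract_sum)
  then have "q i = 0" by (rule poly_p_independent[OF assms(1) _ assms(3)])
  then show ?thesis using d(1) d(2)[of i] assms(3) by simp
qed

section \<open>Simple algebraic extensions\<close>

text \<open>With K the base field, the range of \<open>eval_ac z\<close> is K[z]. It serves as a
  concrete model of the field K(z).\<close>

definition eval_ac :: "'a::field alg_closure \<Rightarrow> 'a poly \<Rightarrow> 'a alg_closure" where
  "eval_ac z P = poly (map_poly to_ac P) z"

lemma eval_ac_add [simp]: "eval_ac z (P + Q) = eval_ac z P + eval_ac z Q"
proof -
  have "map_poly to_ac (P + Q) = map_poly to_ac P + map_poly to_ac Q"
    by (rule poly_eqI) (simp add: coeff_map_poly)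
  then show ?thesis by (simp add: eval_ac_def)
qed

lemma eval_ac_mult [simp]: "eval_ac z (P * Q) = eval_ac z P * eval_ac z Q"
proof -
  have "map_poly to_ac (P * Q) = map_poly to_ac P * map_poly to_ac Q"
    by (rule poly_eqI) (simp add: coeff_map_poly coeff_mult to_ac_sum)
  then show ?thesis by (simp add: eval_ac_def)
qed

lemma eval_ac_pCons [simp]: "eval_ac z (pCons c P) = to_ac c + z * eval_ac z P"
  by (simp add: eval_ac_def map_poly_pCons)

lemma eval_ac_0 [simp]: "eval_ac z 0 = 0"
  by (simp add: eval_ac_def)

lemma eval_ac_1 [simp]: "eval_ac z 1 = 1"
  by (simp add: eval_ac_def)

lemma eval_ac_uminus [simp]: "eval_ac z (- P) = - eval_ac z P"
  using eval_ac_add[of z P "- P"] by (simp add: eq_neg_iff_add_eq_0 add.commute)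

lemma eval_ac_sum: "eval_ac z (\<Sum>i\<in>A. f i) = (\<Sum>i\<in>A. eval_ac z (f i))"
  by (induction A rule: infinite_finite_induct) auto

lemma eval_ac_monom [simp]: "eval_ac z (monom c n) = to_ac c * z ^ n"
  by (simp add: eval_ac_def map_poly_monom poly_monom)

text \<open>The minimal polynomial up to a scalar. The last clause says that the powers of
  \<open>z\<close> below \<open>degree \<mu>\<close> are linearly independent, which is the form
  used later.\<close>

definition is_min_poly :: "'a::field alg_closure \<Rightarrow> 'a poly \<Rightarrow> bool" where
  "is_min_poly z \<mu> \<longleftrightarrow> \<mu> \<noteq> 0 \<and> eval_ac z \<mu> = 0 \<and>
     (\<forall>P. degree P < degree \<mu> \<longrightarrow> eval_ac z P = 0 \<longrightarrow> P = 0)"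

lemma min_poly_exists:
  obtains \<mu> where "is_min_poly z \<mu>"
proof -
  obtain P where P: "P \<noteq> 0 \<and> eval_ac z P = 0"
    using alg_closure_algebraic[of z] unfolding eval_ac_def by blast
  from ex_has_least_nat[where P = "\<lambda>P. P \<noteq> 0 \<and> eval_ac z P = 0", OF P, of degree] show ?thesis
    using that unfolding is_min_poly_def by (metis leD)
qed

text \<open>Euclidean descent: dividing \<mu> = q P + r gives r(z) = -q(z) P(z), so an inverse of
  r(z), available by induction on the degree, yields one of P(z).\<close>

lemma eval_ac_inverse:
  assumes \<mu>: "is_min_poly z \<mu>" and "degree P < degree \<mu>" and "eval_ac z P \<noteq> 0"
  shows "\<exists>Q. eval_ac z Q = inverse (eval_ac z P)"
  using assms(2,3)
proof (induction "degree P" arbitrary: P rule: less_induct)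
  case less
  show ?case
  proof (cases "degree P = 0")
    case True
    then obtain c where "P = [:c:]" by (metis degree_0_id)
    then show ?thesis by (intro exI[of _ "[:inverse c:]"]) simp
  next
    case False
    define r where "r = \<mu> mod P"
    define q where "q = \<mu> div P"
    have \<mu>_eq: "\<mu> = q * P + r" by (simp add: q_def r_def)
    have deg_r: "degree r < degree P"
      using False unfolding r_def by (metis degree_mod_less degree_0 gr_zeroI)
    have ev: "eval_ac z q * eval_ac z P + eval_ac z r = 0"
      using \<mu> \<mu>_eq unfolding is_min_poly_def by (metis eval_ac_add eval_ac_mult)
    \<comment> \<open>Otherwise q(z) = 0 with q of degree below that of \<mu>, since P is not
      constant. Minimality forces q = 0, and then \<mu> = r would have smaller degree than
      P.\<close>
    have "eval_ac z r \<noteq> 0"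
    proof
      assume "eval_ac z r = 0"
      then have "eval_ac z q = 0" using ev less.prems by simp
      moreover have "degree q < degree \<mu>"
      proof (cases "q = 0")
        case True
        then show ?thesis using less.prems by simp
      next
        case False
        then have "degree (q * P) = degree q + degree P"
          using \<open>degree P \<noteq> 0\<close> by (intro degree_mult_eq) auto
        moreover from this have "degree \<mu> = degree (q * P)"
          unfolding \<mu>_eq using deg_r by (intro degree_add_eq_left) simp
        ultimately show ?thesis using \<open>degree P \<noteq> 0\<close> by simp
      qed
      ultimately have "q = 0" using \<mu> unfolding is_min_poly_def by blast
      then show False using \<mu>_eq deg_r less.prems by simp
    qed
    then obtain R where R: "eval_ac z R = inverse (eval_ac z r)"
      using less.hyps[OF deg_r] deg_r less.prems by auto
    have "eval_ac z r = - (eval_ac z q * eval_ac z P)"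
      using ev by (simp add: eq_neg_iff_add_eq_0 add.commute)
    then have "eval_ac z (- R * q) = inverse (eval_ac z P)"
      using R \<open>eval_ac z r \<noteq> 0\<close> less.prems by (simp add: field_simps)
    then show ?thesis ..
  qed
qed

lemma eval_ac_mod:
  assumes "is_min_poly z \<mu>"
  shows "eval_ac z (P mod \<mu>) = eval_ac z P" and "degree (P mod \<mu>) < degree \<mu>"
proof -
  have \<mu>: "\<mu> \<noteq> 0" "eval_ac z \<mu> = 0" using assms by (auto simp: is_min_poly_def)
  have "P = P div \<mu> * \<mu> + P mod \<mu>" by simp
  then have "eval_ac z P = eval_ac z (P div \<mu>) * eval_ac z \<mu> + eval_ac z (P mod \<mu>)"
    by (metis eval_ac_add eval_ac_mult)
  then show "eval_ac z (P mod \<mu>) = eval_ac z P" using \<mu> by simp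
  \<comment> \<open>A nonzero constant cannot vanish at \<open>z\<close>.\<close>
  have "degree \<mu> \<noteq> 0"
    using \<mu> by (metis add.right_neutral degree_0_id eval_ac_0 eval_ac_pCons mult_zero_right pCons_0_0 to_ac_eq_0_iff)
  then show "degree (P mod \<mu>) < degree \<mu>"
    by (metis degree_mod_less \<mu>(1) degree_0 gr_zeroI)
qed

text \<open>Thus K[z] is already a field: reduce modulo the minimal polynomial, then invert.\<close>

lemma range_eval_ac_inverse:
  assumes "h \<in> range (eval_ac z)"
  shows "inverse h \<in> range (eval_ac z)"
proof (cases "h = 0")
  case True
  then show ?thesis by (metis eval_ac_0 inverse_zero rangeI)
next
  case False
  obtain \<mu> where \<mu>: "is_min_poly z \<mu>" by (rule min_poly_exists)
  obtain P where "h = eval_ac z P" using assms by blast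
  then show ?thesis
    using eval_ac_inverse[OF \<mu>, of "P mod \<mu>"] eval_ac_mod[OF \<mu>, of P] False by (metis rangeI)
qed

text \<open>
  By \<open>zp\<close>, the \<open>p\<close>-th power map sends \<open>r z^j\<close> to \<open>r^p s^j z^j\<close>, so it acts on each coordinate
  separately in the basis \<open>1, z, z^2, \<dots>\<close> given by the minimal polynomial of \<open>z\<close>. This avoids
  computing the degree of \<open>z\<close>.
\<close>

lemma extension_p_independent:
  fixes z :: "'a::field alg_closure" and x s :: 'a
  assumes pr: "prime CHAR('a)"
    and indep: "\<And>r i. (\<Sum>i<CHAR('a). r i ^ CHAR('a) * x ^ i) = 0 \<Longrightarrow> i < CHAR('a) \<Longrightarrow> r i = (0::'a)"
    and zp: "z ^ CHAR('a) = to_ac s * z" and s: "s \<noteq> 0"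
    and h: "\<And>i. i < CHAR('a) \<Longrightarrow> h i \<in> range (eval_ac z)"
    and sum0: "(\<Sum>i<CHAR('a). h i ^ CHAR('a) * to_ac x ^ i) = 0"
    and i: "i < CHAR('a)"
  shows "h i = 0"
proof -
  let ?p = "CHAR('a)"
  have p: "?p > 0" using pr by (simp add: prime_gt_0_nat)
  obtain \<mu> where \<mu>: "is_min_poly z \<mu>" by (rule min_poly_exists)
  define d where "d = degree \<mu>"
  have "\<exists>P. h i = eval_ac z P \<and> degree P < d" if "i < ?p" for i
    using h[OF that] eval_ac_mod[OF \<mu>] unfolding d_def by (metis imageE)
  then obtain P where P: "\<And>i. i < ?p \<Longrightarrow> h i = eval_ac z (P i)" "\<And>i. i < ?p \<Longrightarrow> degree (P i) < d"
    by metis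
  have hp: "h i ^ ?p = eval_ac z (\<Sum>j<d. monom (coeff (P i) j ^ ?p * s ^ j) j)" if "i < ?p" for i
  proof -
    have "P i = (\<Sum>j<d. monom (coeff (P i) j) j)"
      using P(2)[OF that] by (intro poly_eqI) (auto simp: coeff_sum coeff_eq_0)
    then have "eval_ac z (P i) = eval_ac z (\<Sum>j<d. monom (coeff (P i) j) j)"
      by (rule arg_cong)
    then have "h i = (\<Sum>j<d. to_ac (coeff (P i) j) * z ^ j)"
      unfolding eval_ac_sum eval_ac_monom P(1)[OF that] .
    then have "h i ^ ?p = (\<Sum>j<d. (to_ac (coeff (P i) j) * z ^ j) ^ ?p)"
      by (simp add: freshmans_dream_sum pr)
    also have "\<dots> = (\<Sum>j<d. to_ac (coeff (P i) j ^ ?p) * (to_ac s * z) ^ j)"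
      unfolding zp[symmetric] to_ac_power power_mult_distrib
      by (simp only: mult.commute[of _ ?p] flip: power_mult)
    finally show ?thesis
      by (simp add: eval_ac_sum power_mult_distrib mult.assoc)
  qed
  \<comment> \<open>The given relation rewritten as a polynomial in \<open>z\<close> of degree below
    \<open>d\<close>. Minimality makes each coefficient vanish, which leaves one relation over the
    base field for every power of \<open>z\<close>.\<close>
  define Q where "Q = (\<Sum>i<?p. \<Sum>j<d. monom (coeff (P i) j ^ ?p * s ^ j * x ^ i) j)"
  have "eval_ac z Q = (\<Sum>i<?p. h i ^ ?p * to_ac x ^ i)"
    unfolding Q_def by (auto simp: eval_ac_sum hp sum_distrib_left sum_distrib_right mult_ac intro!: sum.cong)
  then have "eval_ac z Q = 0" using sum0 by simp
  moreover have cQ: "coeff Q j = (if j < d then \<Sum>i<?p. coeff (P i) j ^ ?p * s ^ j * x ^ i else 0)" for j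
    unfolding Q_def by (simp add: coeff_sum)
  moreover have "d > 0" using eval_ac_mod(2)[OF \<mu>, of 0] by (simp add: d_def)
  then have "degree Q < d"
    using cQ[of "degree Q"] by (cases "Q = 0") (auto split: if_splits)
  ultimately have "Q = 0" using \<mu> unfolding is_min_poly_def d_def by blast
  have "coeff (P i) j = 0" for j
  proof (cases "j < d")
    case True
    \<comment> \<open>The factor \<open>s ^ j\<close> is common to all terms and nonzero, so what
      remains is a relation to which \<open>indep\<close> applies.\<close>
    have "s ^ j * (\<Sum>i<?p. coeff (P i) j ^ ?p * x ^ i) = 0"
      using cQ[of j] True \<open>Q = 0\<close> by (simp add: sum_distrib_left mult_ac)
    then show ?thesis using indep[of "\<lambda>i. coeff (P i) j"] s i by simp
  next
    case False
    then show ?thesis using P(2)[OF i] by (simp add: coeff_eq_0)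
  qed
  then have "P i = 0" by (simp add: poly_eq_iff)
  then show ?thesis using P(1)[OF i] by simp
qed

section \<open>Binomial sums and the hypergeometric recursion\<close>

text \<open>Comparing coefficients at exponent j turns the equation into (j+1)(j+C) u_(j+1) =
  (j+A)(j+B) u_j. With these exact parameters it holds in any characteristic; reduction modulo p
  only matters when matching A, B, C.\<close>

lemma hypergeometric_eq_sum_binomial:
  fixes e A B C :: "'a::idom" and b c n :: nat
  defines "u \<equiv> (\<Sum>j\<le>n. monom (e * of_nat ((b choose (n - j)) * (c choose j))) j)"
  assumes A: "A = - of_nat n" and B: "B = - of_nat c" and C: "C = of_nat b - of_nat n + 1"
  shows "[:0, 1:] * (1 - [:0, 1:]) * pderiv (pderiv u)
       + ([:C:] - [:A + B + 1:] * [:0, 1:]) * pderiv u - [:A * B:] * u = 0"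
proof -
  have cu: "coeff u j = (if j \<le> n then e * of_nat ((b choose (n - j)) * (c choose j)) else 0)" for j
    by (simp add: u_def coeff_sum)
  \<comment> \<open>The difference is taken in the ring, so the identity also covers k > N, where
    both binomials vanish.\<close>
  have absorb: "of_nat (Suc k) * of_nat (N choose Suc k) = (of_nat N - of_nat k) * (of_nat (N choose k) :: 'a)"
    for N k
  proof (cases "k \<le> N")
    case True
    have "Suc k * (N choose Suc k) = (N - k) * (N choose k)"
      by (metis binomial_absorb_comp binomial_absorption diff_Suc_1)
    then show ?thesis
      using True by (metis of_nat_diff of_nat_mult)
  qed (simp add: binomial_eq_0)
  \<comment> \<open>For n = j+1+k one has j+C = b-k, j+A = -(k+1) and j+B = -(c-j), so two
    absorptions suffice. At j = n the factor j+A vanishes, and beyond n both coefficients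
    do.\<close>
  have rec: "of_nat (Suc j) * (of_nat j + C) * coeff u (Suc j) = (of_nat j + A) * (of_nat j + B) * coeff u j" for j
  proof (cases "j < n")
    case True
    then obtain k where k: "n = Suc (j + k)" by (metis less_iff_Suc_add)
    have "of_nat (Suc j) * (of_nat j + C) * coeff u (Suc j) =
        e * (of_nat (Suc j) * of_nat (c choose Suc j)) * ((of_nat b - of_nat k) * of_nat (b choose k))"
      using k by (simp add: cu C algebra_simps)
    also have "\<dots> = e * ((of_nat c - of_nat j) * of_nat (c choose j)) * (of_nat (Suc k) * of_nat (b choose Suc k))"
      by (simp only: absorb)
    also have "\<dots> = (of_nat j + A) * (of_nat j + B) * coeff u j"
      using k by (simp add: cu A B algebra_simps)
    finally show ?thesis .
  qed (auto simp: cu A)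
  have X: "1 - [:0, 1:] = [:1, -1 :: 'a:]" by (simp add: one_pCons)
  have "coeff ([:0, 1:] * (1 - [:0, 1:]) * pderiv (pderiv u)
       + ([:C:] - [:A + B + 1:] * [:0, 1:]) * pderiv u - [:A * B:] * u) j =
      of_nat (Suc j) * (of_nat j + C) * coeff u (Suc j) - (of_nat j + A) * (of_nat j + B) * coeff u j" for j
    unfolding X
    by (auto simp: coeff_pCons coeff_pderiv algebra_simps split: nat.splits)
  then show ?thesis using rec by (intro poly_eqI) simp
qed

lemma coeff_linear_poly_power': "coeff ([:a, 1:] ^ n) i = of_nat (n choose i) * a ^ (n - i)"
  for a :: "'a::comm_ring_1"
proof (cases "i \<le> n")
  case False
  then have "degree ([:a, 1:] ^ n) < i"
    by (metis degree_linear_power not_le)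
  with False show ?thesis by (simp add: coeff_eq_0 binomial_eq_0)
qed (simp add: coeff_linear_poly_power)

text \<open>Expand the convolution and index it by the exponent j of t. Symmetry of the binomials
  rewrites both factors, and the signs (-1)^(b-k) and (-1)^j combine to (-1)^n.\<close>

lemma coeff_linear_powers_mult:
  fixes t :: "'a::comm_ring_1"
  assumes "b + c = M + n"
  shows "coeff ([:-1, 1:] ^ b * [:-t, 1:] ^ c) M =
    (\<Sum>j\<le>n. (- 1) ^ n * of_nat ((b choose (n - j)) * (c choose j)) * t ^ j)"
proof -
  have "coeff ([:-1, 1:] ^ b * [:-t, 1:] ^ c) M =
      (\<Sum>k\<le>M. of_nat (b choose k) * (-1) ^ (b - k) * (of_nat (c choose (M - k)) * (-t) ^ (c - (M - k))))"
    by (simp add: coeff_mult coeff_linear_poly_power')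
  \<comment> \<open>Keeping only indices with nonzero binomials prevents truncated subtraction, so
    that the change of index is a bijection.\<close>
  also have "\<dots> = (\<Sum>k | k \<le> M \<and> k \<le> b \<and> M - k \<le> c.
      of_nat (b choose k) * (-1) ^ (b - k) * (of_nat (c choose (M - k)) * (-t) ^ (c - (M - k))))"
  proof (intro sum.mono_neutral_right ballI)
    fix k assume "k \<in> {..M} - {k. k \<le> M \<and> k \<le> b \<and> M - k \<le> c}"
    then have "b < k \<or> c < M - k" by auto
    then show "of_nat (b choose k) * (-1) ^ (b - k) * (of_nat (c choose (M - k)) * (-t) ^ (c - (M - k))) = 0"
      by (auto simp: binomial_eq_0)
  qed auto
  also have "\<dots> = (\<Sum>j | j \<le> n \<and> j \<le> c \<and> n - j \<le> b.
      (- 1) ^ n * of_nat ((b choose (n - j)) * (c choose j)) * t ^ j)"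
  proof (rule sum.reindex_bij_witness[where i = "\<lambda>j. b - (n - j)" and j = "\<lambda>k. c - (M - k)"])
    fix k assume "k \<in> {k. k \<le> M \<and> k \<le> b \<and> M - k \<le> c}"
    then have k: "k \<le> M" "k \<le> b" "M - k \<le> c" by auto
    define i where "i = b - k"
    define j where "j = c - (M - k)"
    have ij: "n = i + j" "n - j = b - k" "M - k = c - j" "j \<le> c"
      using k assms by (auto simp: i_def j_def)
    have "b choose (n - j) = b choose k" "c choose (M - k) = c choose j"
      using k ij binomial_symmetric by metis+
    then show "(- 1) ^ n * of_nat ((b choose (n - (c - (M - k)))) * (c choose (c - (M - k)))) * t ^ (c - (M - k)) =
        of_nat (b choose k) * (-1) ^ (b - k) * (of_nat (c choose (M - k)) * (-t) ^ (c - (M - k)))"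
      unfolding j_def[symmetric] i_def[symmetric] power_minus[of t] ij(1)
      by (simp add: power_add mult_ac)
  qed (use assms in auto)
  also have "\<dots> = (\<Sum>j\<le>n. (- 1) ^ n * of_nat ((b choose (n - j)) * (c choose j)) * t ^ j)"
  proof (intro sum.mono_neutral_left ballI)
    fix j assume "j \<in> {..n} - {j. j \<le> n \<and> j \<le> c \<and> n - j \<le> b}"
    then have "c < j \<or> b < n - j" by auto
    then show "(- 1) ^ n * of_nat ((b choose (n - j)) * (c choose j)) * t ^ j = 0"
      by (auto simp: binomial_eq_0)
  qed auto
  finally show ?thesis .
qed

section \<open>The function field of the curve\<close>

lemma carrier_ring_of_type_algebra [simp]: "carrier ring_of_type_algebra = UNIV"
  and mult_ring_of_type_algebra [simp]: "x \<otimes>\<^bsub>ring_of_type_algebra\<^esub> y = x * y"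
  and add_ring_of_type_algebra [simp]: "x \<oplus>\<^bsub>ring_of_type_algebra\<^esub> y = x + y"
  and one_ring_of_type_algebra [simp]: "\<one>\<^bsub>ring_of_type_algebra\<^esub> = 1"
  and zero_ring_of_type_algebra [simp]: "\<zero>\<^bsub>ring_of_type_algebra\<^esub> = 0"
  for x y :: "'a::ring_1"
  by (simp_all add: ring_of_type_algebra_def)

lemma a_inv_ring_of_type_algebra [simp]: "\<ominus>\<^bsub>ring_of_type_algebra\<^esub> x = - x"
  for x :: "'a::comm_ring_1"
proof -
  interpret R: ring "ring_of_type_algebra :: 'a ring" ..
  show ?thesis by (rule R.minus_equality) simp_all
qed

lemma m_inv_ring_of_type_algebra [simp]:
  "x \<noteq> 0 \<Longrightarrow> inv\<^bsub>ring_of_type_algebra\<^esub> x = inverse x"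
  for x :: "'a::Fields.field"
proof -
  interpret R: cring "ring_of_type_algebra :: 'a ring" ..
  show "x \<noteq> 0 \<Longrightarrow> inv\<^bsub>ring_of_type_algebra\<^esub> x = inverse x"
    by (rule R.comm_inv_char) simp_all
qed

context
  fixes H :: "'a::Fields.field set"
begin

abbreviation "gen \<equiv> generate_field ring_of_type_algebra H"

lemma generate_field_1: "1 \<in> gen"
  using generate_field.one[of ring_of_type_algebra H] by simp

lemma generate_field_add: "x \<in> gen \<Longrightarrow> y \<in> gen \<Longrightarrow> x + y \<in> gen"
  using generate_field.eng_add[of x ring_of_type_algebra H y] by simp

lemma generate_field_mult: "x \<in> gen \<Longrightarrow> y \<in> gen \<Longrightarrow> x * y \<in> gen"
  using generate_field.eng_mult[of x ring_of_type_algebra H y] by simp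

lemma generate_field_diff: "x \<in> gen \<Longrightarrow> y \<in> gen \<Longrightarrow> x - y \<in> gen"
  using generate_field_add[of x "- y"] generate_field.a_inv[of y ring_of_type_algebra H] by simp

lemma generate_field_divide: "x \<in> gen \<Longrightarrow> y \<in> gen \<Longrightarrow> x / y \<in> gen"
  \<comment> \<open>For \<open>y = 0\<close> the quotient is 0, which is \<open>y\<close> itself and
    hence in the field.\<close>
  using generate_field_mult[of x "inverse y"] generate_field.m_inv[of y ring_of_type_algebra H]
  by (cases "y = 0") (auto simp: divide_inverse)

end

abbreviation emb_poly :: "'k::Fields.field const_field poly \<Rightarrow> 'k ambient" where
  "emb_poly f \<equiv> to_ac (to_fract f)"

lemma emb_poly_pCons: "emb_poly (pCons c f) = const_emb c + var_x * emb_poly f"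
proof -
  have "emb_poly (pCons c f) = emb_poly ([:c:] + [:0, 1:] * f)" by simp
  also have "\<dots> = const_emb c + var_x * emb_poly f"
    by (simp only: const_emb_def var_x_def to_ac_add to_ac_mult to_fract_add to_fract_mult)
  finally show ?thesis .
qed

lemma emb_poly_in_curve_field: "emb_poly f \<in> curve_field z"
proof (induction f)
  case 0
  show ?case
    using generate_field_diff[OF generate_field_1 generate_field_1] by (simp add: curve_field_def)
next
  case (pCons c f)
  then show ?case
    unfolding emb_poly_pCons curve_field_def
    by (intro generate_field_add generate_field_mult) (auto intro: generate_field.incl)
qed

lemma var_x_minus_lam: "var_x - lam = emb_poly [:- at_lambda [:0, 1:], 1:]"
  and var_x_minus_1: "var_x - 1 = emb_poly [:- 1, 1:]"
proof -
  have "to_fract [:0, 1:] - to_fract [:c:] = to_fract [:- c, 1:]" for c :: "'k::Fields.field const_field"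
    by (simp flip: to_fract_diff)
  then have *: "var_x - const_emb c = emb_poly [:- c, 1:]" for c :: "'k::Fields.field const_field"
    by (simp add: var_x_def const_emb_def flip: to_ac_diff)
  show "var_x - lam = emb_poly [:- at_lambda [:0, 1:], 1:]"
    unfolding lam_def by (rule *)
  show "var_x - 1 = emb_poly [:- 1, 1:]"
    using *[of 1] by (simp add: const_emb_def flip: one_pCons)
qed

lemma omega_in_curve_field: "omega z \<in> curve_field z"
proof -
  have "z \<in> curve_field z" by (auto simp: curve_field_def intro: generate_field.incl)
  then show ?thesis
    unfolding omega_def var_x_minus_lam var_x_minus_1
    using emb_poly_in_curve_field unfolding var_x_def curve_field_def
    by (intro generate_field_divide generate_field_mult) auto
qed

text \<open>K[z] contains the generators and is closed under inverses, so independence proved there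
  also holds in the function field.\<close>

lemma curve_field_subset: "curve_field z \<subseteq> range (eval_ac z)"
proof
  fix h assume "h \<in> curve_field z"
  then show "h \<in> range (eval_ac z)"
    unfolding curve_field_def
  proof induction
    case one
    show ?case using eval_ac_1 by (metis one_ring_of_type_algebra rangeI)
  next
    case (incl h)
    have "eval_ac z [:c:] = to_ac c" for c by simp
    then have "to_ac c \<in> range (eval_ac z)" for c by (metis rangeI)
    moreover have "eval_ac z [:0, 1:] = z" by simp
    then have "z \<in> range (eval_ac z)" by (metis rangeI)
    ultimately show ?case using incl by (auto simp: const_emb_def var_x_def)
  next
    case (a_inv h)
    then show ?case by (auto simp flip: eval_ac_uminus)
  next
    case (m_inv h)
    then show ?case using range_eval_ac_inverse by simp
  next
    case (eng_add h1 h2)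
    then show ?case by (auto simp flip: eval_ac_add)
  next
    case (eng_mult h1 h2)
    then show ?case by (auto simp flip: eval_ac_mult)
  qed
qed

section \<open>Evaluating the Cartier operator\<close>

text \<open>The description in \<open>cartier\<close> is proper because two expansions of
  \<open>f\<close> differ by an expansion of 0, Frobenius being additive, and p-independence makes
  the difference vanish.\<close>

lemma cartier_eqI:
  fixes z :: "'k::alg_closed_field ambient"
  assumes pr: "prime CHAR('k)" and zp: "z ^ CHAR('k) = to_ac s * z" "s \<noteq> 0"
    and g: "\<And>i. i < CHAR('k) \<Longrightarrow> g i \<in> curve_field z"
    and f: "f = (\<Sum>i<CHAR('k). g i ^ CHAR('k) * var_x ^ i)"
  shows "cartier (curve_field z) var_x f = g (CHAR('k) - 1)"
  unfolding cartier_def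
proof (rule the1_equality')
  let ?p = "CHAR('k)"
  have p: "?p > 0" using pr by (simp add: prime_gt_0_nat)
  show "\<exists>g'. (\<forall>i<CHAR('k ambient). g' i \<in> curve_field z) \<and>
      f = (\<Sum>i<CHAR('k ambient). g' i ^ CHAR('k ambient) * var_x ^ i) \<and>
      g (?p - 1) = g' (CHAR('k ambient) - 1)"
    using g f by auto
  show "\<exists>\<^sub>\<le>\<^sub>1 h. \<exists>g. (\<forall>i<CHAR('k ambient). g i \<in> curve_field z) \<and>
      f = (\<Sum>i<CHAR('k ambient). g i ^ CHAR('k ambient) * var_x ^ i) \<and>
      h = g (CHAR('k ambient) - 1)"
  proof (rule Uniq_I, clarsimp)
    fix g1 g2
    assume g1: "\<forall>i<?p. g1 i \<in> curve_field z" and g2: "\<forall>i<?p. g2 i \<in> curve_field z"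
      and eq: "(\<Sum>i<?p. g2 i ^ ?p * var_x ^ i) = (\<Sum>i<?p. g1 i ^ ?p * var_x ^ i)"
    define h where "h i = g1 i - g2 i" for i
    have hp: "h i ^ ?p = g1 i ^ ?p - g2 i ^ ?p" for i
    proof -
      have "(h i + g2 i) ^ ?p = h i ^ ?p + g2 i ^ ?p"
        by (rule freshmans_dream) (simp_all add: pr)
      moreover have "h i + g2 i = g1 i" by (simp add: h_def)
      ultimately show ?thesis by simp
    qed
    then have "(\<Sum>i<?p. h i ^ ?p * var_x ^ i) = 0"
      using eq by (simp add: hp left_diff_distrib sum_subtractf)
    moreover have "h i \<in> range (eval_ac z)" if "i < ?p" for i
    proof -
      have "h i \<in> curve_field z"
        using g1 g2 that unfolding h_def curve_field_def by (auto intro: generate_field_diff)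
      then show ?thesis using curve_field_subset by blast
    qed
    ultimately have "h (?p - 1) = 0"
      using extension_p_independent[of "to_fract [:0, 1:]" z s h "?p - 1"]
        fract_p_independent[where 'a = "'k const_field"] pr zp p
      by (simp add: var_x_def)
    then show "g1 (?p - Suc 0) = g2 (?p - Suc 0)" by (simp add: h_def)
  qed
qed

lemma const_emb_eq_iff [simp]: "const_emb c = const_emb d \<longleftrightarrow> c = d"
  by (simp add: const_emb_def)

lemma at_lambda_eq_iff [simp]: "at_lambda f = at_lambda g \<longleftrightarrow> f = g"
  by (simp add: at_lambda_def)

lemma var_x_nonzero: "var_x \<noteq> 0" "var_x - 1 \<noteq> 0" "var_x - lam \<noteq> 0"
  unfolding var_x_minus_lam var_x_minus_1 by (simp_all add: var_x_def)

section \<open>The explicit Hasse invariant\<close>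

lemma hasse_invariant_eq:
  fixes m \<alpha> a1 a2 a3 a4 :: nat
  assumes pr: "prime CHAR('k::alg_closed_field)" and m: "m > 0" and pm: "CHAR('k) - 1 = \<alpha> * m"
    and a: "a1 < m" "a2 < m" "a3 < m" "a4 < m" "a1 + a2 + a3 + a4 = 2 * m"
  shows "hasse_invariant m a1 a2 a4 = (\<Sum>j\<le>\<alpha> * a3. monom ((- 1) ^ (\<alpha> * a3) *
     of_nat ((\<alpha> * (m - a2) choose (\<alpha> * a3 - j)) * (\<alpha> * (m - a4) choose j))) j :: 'k poly)"
    (is "_ = ?\<Phi>")
proof -
  let ?p = "CHAR('k)"
  have "?p > 0" using pr by (simp add: prime_gt_0_nat)
  with pm have p: "?p > 0" "?p = Suc (\<alpha> * m)" by simp_all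
  define t :: "'k const_field" where "t = at_lambda [:0, 1:]"
  define N1 where "N1 = [:-1, 1:] ^ (\<alpha> * (m - a2)) * [:-t, 1:] ^ (\<alpha> * (m - a4))"
  define N where "N = monom 1 (\<alpha> * (m - a1)) * N1"
  \<comment> \<open>From the sum 2m of the \<open>a\<close>'s. The first identity is the hypothesis
    of \<open>coeff_linear_powers_mult\<close> with M = \<alpha> a1 and n = \<alpha> a3; the second
    says that the factor x^(\<alpha>(m-a1)) moves exponent M to p-1.\<close>
  have "(m - a2) + (m - a4) = a1 + a3" "m = (m - a1) + a1" using a by linarith+
  then have exps: "\<alpha> * (m - a2) + \<alpha> * (m - a4) = \<alpha> * a1 + \<alpha> * a3"
    "\<alpha> * m = \<alpha> * (m - a1) + \<alpha> * a1"
    by (simp_all only: flip: distrib_left)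
  have "at_lambda ?\<Phi> = (\<Sum>j\<le>\<alpha> * a3. (- 1) ^ (\<alpha> * a3) *
     of_nat ((\<alpha> * (m - a2) choose (\<alpha> * a3 - j)) * (\<alpha> * (m - a4) choose j)) * t ^ j)"
  proof -
    have "(monom ((- 1) ^ n * of_nat N) j :: 'k poly) = (- 1) ^ n * of_nat N * [:0, 1:] ^ j" for n N j
      by (simp add: monom_altdef of_nat_poly minus_one_power_iff)
    then show ?thesis
      by (simp add: at_lambda_def t_def to_ac_sum to_fract_power to_fract_of_nat
               del: of_nat_mult)
  qed
  then have "coeff N1 (\<alpha> * a1) = at_lambda ?\<Phi>"
    unfolding N1_def using coeff_linear_powers_mult[OF exps(1), of t] by simp
  then have coeff_N: "coeff N (?p - 1) = at_lambda ?\<Phi>"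
    unfolding N_def pm exps(2) by (simp add: coeff_monom_mult)
  \<comment> \<open>The next exponent congruent to p-1 is 2p-1, so this bound makes the last
    component of \<open>N\<close> constant.\<close>
  have deg_N: "degree N < 2 * ?p - 1"
  proof -
    have "degree N \<le> \<alpha> * (m - a1) + (\<alpha> * (m - a2) + \<alpha> * (m - a4))"
      unfolding N_def N1_def
      by (intro order_trans[OF degree_mult_le] add_mono degree_monom_le)
         (simp_all add: degree_linear_power)
    also have "\<dots> = \<alpha> * m + \<alpha> * a3" using exps by simp
    also have "\<dots> \<le> \<alpha> * m + \<alpha> * m" using a by simp
    also have "\<dots> < 2 * ?p - 1" using p(2) by simp
    finally show ?thesis .
  qed
  obtain q where q: "N = (\<Sum>i<?p. q i ^ ?p * [:0, 1:] ^ i)"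
    using poly_p_decomposition[of N] pr by auto
  have "coeff (q i) k ^ ?p = coeff N (?p * k + i)" if "i < ?p" for i k
    using coeff_sum_power_CHAR[of q "?p * k + i"] pr q that by simp
  then have cq: "coeff (q (?p - 1)) k ^ ?p = coeff N (?p * k + (?p - 1))" for k
    using p(1) by simp
  define c where "c = coeff (q (?p - 1)) 0"
  have c: "c ^ ?p = at_lambda ?\<Phi>"
    using cq[of 0] coeff_N by (simp add: c_def)
  have "coeff (q (?p - 1)) k = coeff [:c:] k" for k
  proof (cases k)
    case (Suc l)
    then have "coeff N (?p * k + (?p - 1)) = 0"
      using deg_N p(1) by (intro coeff_eq_0) simp
    then show ?thesis using cq[of k] Suc by simp
  qed (simp add: c_def)
  then have q_last: "q (?p - 1) = [:c:]" by (rule poly_eqI)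
  have curve: "omega z \<noteq> 0 \<and> cartier (curve_field z) var_x (omega z) = const_emb c * omega z"
    if z: "on_curve m a1 a2 a4 z" for z :: "'k ambient"
  proof -
    \<comment> \<open>Since p = \<alpha> m + 1, z^p = (z^m)^\<alpha> z, and the curve equation makes
      (z^m)^\<alpha> the polynomial \<open>r\<close> in x. This is the scalar \<open>s\<close>
      required by \<open>cartier_eqI\<close>.\<close>
    define r :: "'k const_field poly" where
      "r = ([:0, 1:] ^ a1 * [:-1, 1:] ^ a2 * [:- t, 1:] ^ a4) ^ \<alpha>"
    have zm: "z ^ m = var_x ^ a1 * (var_x - 1) ^ a2 * (var_x - lam) ^ a4"
      using z by (simp add: on_curve_def)
    have z0: "z \<noteq> 0"
      using zm m var_x_nonzero by (auto simp: zero_power)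
    then have \<omega>0: "omega z \<noteq> 0" using var_x_nonzero by (simp add: omega_def)
    have zp: "z ^ ?p = emb_poly r * z"
    proof -
      have "z ^ ?p = (z ^ m) ^ \<alpha> * z"
        by (simp add: p(2) mult.commute flip: power_mult)
      also have "(z ^ m) ^ \<alpha> = emb_poly r"
        unfolding zm r_def var_x_minus_lam var_x_minus_1 t_def
        by (simp add: var_x_def to_fract_power del: power_mult)
      finally show ?thesis .
    qed
    \<comment> \<open>The exponents \<alpha> a and \<alpha>(m-a) add up to p-1 for each linear
      factor, so against the p-th power in the denominator one copy of each remains.\<close>
    have "omega z ^ ?p * emb_poly N = omega z"
    proof -
      define x0 :: "'k ambient" where "x0 = var_x"
      define x1 :: "'k ambient" where "x1 = var_x - 1"
      define xl :: "'k ambient" where "xl = var_x - lam"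
      have nz: "x0 \<noteq> 0" "x1 \<noteq> 0" "xl \<noteq> 0"
        using var_x_nonzero by (simp_all add: x0_def x1_def xl_def)
      have N: "emb_poly N = x0 ^ (\<alpha> * (m - a1)) * x1 ^ (\<alpha> * (m - a2)) * xl ^ (\<alpha> * (m - a4))"
        unfolding x0_def x1_def xl_def var_x_minus_lam var_x_minus_1 N_def N1_def t_def
        by (simp add: var_x_def monom_altdef to_fract_power mult.assoc)
      have pw: "T ^ (\<alpha> * a) * T ^ (\<alpha> * (m - a)) = T ^ (\<alpha> * m)" if "a < m" for T :: "'k ambient" and a
        using that by (simp flip: power_add distrib_left)
      have "z ^ ?p = (z ^ m) ^ \<alpha> * z"
        by (simp add: p(2) mult.commute flip: power_mult)
      also have "\<dots> = x0 ^ (\<alpha> * a1) * x1 ^ (\<alpha> * a2) * xl ^ (\<alpha> * a4) * z"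
        unfolding zm x0_def x1_def xl_def by (simp add: power_mult_distrib mult.commute flip: power_mult)
      finally have "z ^ ?p * emb_poly N =
        (x0 ^ (\<alpha> * a1) * x0 ^ (\<alpha> * (m - a1))) * (x1 ^ (\<alpha> * a2) * x1 ^ (\<alpha> * (m - a2)))
         * (xl ^ (\<alpha> * a4) * xl ^ (\<alpha> * (m - a4))) * z"
        unfolding N by (simp only: mult_ac)
      also have "\<dots> = (x0 * x1 * xl) ^ (\<alpha> * m) * z"
        using a by (simp add: pw power_mult_distrib)
      finally have eq: "z ^ ?p * emb_poly N = (x0 * x1 * xl) ^ (\<alpha> * m) * z" .
      have "omega z = z / (x0 * x1 * xl)"
        by (simp add: omega_def x0_def x1_def xl_def)
      then have "omega z ^ ?p * emb_poly N = (x0 * x1 * xl) ^ (\<alpha> * m) * z / (x0 * x1 * xl) ^ ?p"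
        by (simp only: power_divide times_divide_eq_left eq)
      also have "\<dots> = z / (x0 * x1 * xl)"
        unfolding p(2) power_Suc2 using nz by simp
      finally show ?thesis by (simp only: \<open>omega z = z / (x0 * x1 * xl)\<close>)
    qed
    \<comment> \<open>Inserting the expansion of \<open>N\<close> gives an expansion of \<omega>
      with components \<omega> q_i, all in the function field.\<close>
    then have "omega z = (\<Sum>i<?p. (omega z * emb_poly (q i)) ^ ?p * var_x ^ i)"
      by (subst (asm) q) (simp add: to_ac_sum to_fract_power var_x_def power_mult_distrib sum_distrib_left mult.assoc)
    moreover have "omega z * emb_poly f \<in> curve_field z" for f
      using omega_in_curve_field[of z] emb_poly_in_curve_field[of f z]
      unfolding curve_field_def by (rule generate_field_mult)
    moreover have "to_fract r \<noteq> 0" by (simp add: r_def)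
    ultimately have "cartier (curve_field z) var_x (omega z) = omega z * emb_poly (q (?p - 1))"
      by (intro cartier_eqI[where g = "\<lambda>i. omega z * emb_poly (q i)", OF pr zp])
    then show ?thesis
      using \<omega>0 unfolding q_last by (simp add: const_emb_def mult.commute)
  qed
  have "set (coeffs ?\<Phi>) \<subseteq> \<int>"
    by (auto simp: coeffs_def coeff_sum)
  with c curve have "is_hasse_invariant m a1 a2 a4 ?\<Phi>"
    unfolding is_hasse_invariant_def by blast
  moreover have "\<Phi> = ?\<Phi>" if "is_hasse_invariant m a1 a2 a4 \<Phi>" for \<Phi> :: "'k poly"
  proof -
    \<comment> \<open>A point z must exist for the condition on \<Phi> not to be vacuous. As
      \<omega> is nonzero, its eigenvalue is then determined, and with it the p-th power at_lambda
      \<Phi>.\<close>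
    obtain z :: "'k ambient" where z: "on_curve m a1 a2 a4 z"
      unfolding on_curve_def using nth_root_exists[OF m] by blast
    with that obtain d where d: "d ^ ?p = at_lambda \<Phi>"
      "cartier (curve_field z) var_x (omega z) = const_emb d * omega z"
      unfolding is_hasse_invariant_def by blast
    then have "d = c" using curve[OF z] by simp
    then show ?thesis using c d(1) by simp
  qed
  ultimately show ?thesis
    unfolding hasse_invariant_def by (rule the_equality)
qed

section \<open>The differential equation\<close>

theorem proposition5p4:
  fixes p m \<alpha> a1 a2 a3 a4 :: nat and A B C :: int
    and u :: "'k::alg_closed_field poly"
  assumes "prime p" and "odd p" and "CHAR('k) = p"
    and "m > 1" and "[p = 1] (mod m)" and "\<alpha> = (p - 1) div m"
    and "0 < a1" "a1 < m" "0 < a2" "a2 < m" "0 < a3" "a3 < m" "0 < a4" "a4 < m"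
    and "Gcd {m, a1, a2, a3, a4} = 1"
    and "a1 + a2 + a3 + a4 = 2 * m"
    and "[A = - (int \<alpha> * int a3)] (mod int p)"
    and "[B = int \<alpha> * (int a4 - int m)] (mod int p)"
    and "[C = - (int \<alpha> * (int a2 + int a3))] (mod int p)"
    and "u = hasse_invariant m a1 a2 a4"
  shows "[:0, 1:] * (1 - [:0, 1:]) * pderiv (pderiv u)
       + ([:of_int C:] - [:of_int (A + B + 1):] * [:0, 1:]) * pderiv u
       - [:of_int (A * B):] * u = 0"
proof -
  have "p > 1" using assms(1) by (rule prime_gt_1_nat)
  then have "m dvd p - 1"
    using assms(5) mod_eq_dvd_iff_nat[of 1 p m] by (simp add: cong_def)
  then have pm: "p - 1 = \<alpha> * m" using assms(6) by simp
  have of_int_eq: "(of_int x :: 'k) = of_int y" if "[x = y] (mod int p)" for x y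
    using that assms(3) by (simp add: of_int_eq_iff_cong_CHAR)
  have A: "(of_int A :: 'k) = - of_nat (\<alpha> * a3)"
    using of_int_eq[OF assms(17)] by simp
  have B: "(of_int B :: 'k) = - of_nat (\<alpha> * (m - a4))"
    using of_int_eq[OF assms(18)] assms(14) by (simp add: of_nat_diff algebra_simps)
  \<comment> \<open>Here \<alpha> m + 1 = p, so the parameter b - n + 1 of the recursion differs
    from -\<alpha>(a2+a3) by exactly p.\<close>
  have "int (\<alpha> * (m - a2)) - int (\<alpha> * a3) + 1 = - (int \<alpha> * (int a2 + int a3)) + int p"
    using pm \<open>p > 1\<close> assms(10) by (simp add: of_nat_diff algebra_simps flip: of_nat_mult)
  then have "[C = int (\<alpha> * (m - a2)) - int (\<alpha> * a3) + 1] (mod int p)"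
    using assms(19) by (simp add: cong_def)
  from of_int_eq[OF this] have C: "(of_int C :: 'k) = of_nat (\<alpha> * (m - a2)) - of_nat (\<alpha> * a3) + 1"
    by simp
  have "u = (\<Sum>j\<le>\<alpha> * a3. monom ((- 1) ^ (\<alpha> * a3) *
     of_nat ((\<alpha> * (m - a2) choose (\<alpha> * a3 - j)) * (\<alpha> * (m - a4) choose j))) j)"
    unfolding assms(20) by (rule hasse_invariant_eq) (use assms pm in auto)
  then show ?thesis
    using hypergeometric_eq_sum_binomial[OF A B C] by simp
qed

end
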